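(* There exists a distinct covering system with least modulus $m=8$ whose moduli have least common multiple $L = 2^8 3^3 5^2$.
   Context: A covering system is a finite set of congruences $x \equiv r_i \pmod{n_i}$, $i=1,\ldots,k$, such that every integer satisfies at least one of the congruences. A distinct covering system is a covering system in which all moduli $n_i$ are distinct integers greater than $1$. The least modulus $m$ is the smallest of the $n_i$, and $L$ is the least common multiple of all the $n_i$. *)

theory Defs
  imports "HOL-Number_Theory.Cong"
begin

(* A pair (r, n) stands for the congruence x = r (mod n). *)
type_synonym congruence = "int \<times> int"

definition moduli :: "congruence set \<Rightarrow> int set" where
  "moduli S = snd ` S"

definition covering_system :: "congruence set \<Rightarrow> bool" where
  "covering_system S \<longleftrightarrow>
     finite S \<and> (\<forall>(r, n) \<in> S. n > 0) \<and> (\<forall>x. \<exists>(r, n) \<in> S. [x = r] (mod n))"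

(* Injectivity of snd: no two congruences of S, not even two with equal residue
   classes but different representatives, share a modulus. *)
definition distinct_covering_system :: "congruence set \<Rightarrow> bool" where
  "distinct_covering_system S \<longleftrightarrow>
     covering_system S \<and> inj_on snd S \<and> (\<forall>n \<in> moduli S. n > 1)"

definition least_modulus :: "congruence set \<Rightarrow> int" where
  "least_modulus S = Min (moduli S)"

definition lcm_of_moduli :: "congruence set \<Rightarrow> int" where
  "lcm_of_moduli S = Lcm (moduli S)"

end

theory Submission
  imports Defs
begin

text \<open>
  The proof exhibits a system of 96 congruences together with a partition of the integers into
  126 residue classes, each lying inside a single congruence of the system. The partition is a
  tree (\<open>covering_tree\<close>): its root is the class of all integers, and a node that is a
  residue class modulo \<open>m\<close> is either divided into its 2, 3 or 5 subclasses modulo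
  \<open>2m\<close>, \<open>3m\<close> or \<open>5m\<close>, or it is a leaf, where the class is contained in
  a congruence whose modulus divides \<open>m\<close>. Lemma \<open>covers_sound\<close> turns a tree
  whose leaves pass this finite test into a statement about all integers.

  Almost nothing may be wasted: the reciprocals of the divisors of
  \<open>2^8 * 3^3 * 5^2\<close> that are at least 8 add up to less than 1.22. The main economy is the
  power of 2 in the modulus. If a class modulo \<open>m\<close> is still open, then the moduli
  \<open>2m\<close>, \<open>4m\<close>, \<open>8m\<close>, and so on, cover without any overlap one half of
  what is left at each step. For example 8, 16, 32, 64, 128, 256 cover all of the class 1 mod 4
  except 53 mod 256, and 24, 48, 96, 192, 384 cover all of 3 mod 12 except 75 mod 384. Such a
  remainder is small enough for the overlaps that arise when it is divided by 3 or 5.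

  The second economy is that one congruence serves many branches: a class modulo \<open>n\<close>
  takes its full share of every branch whose modulus is coprime to \<open>n\<close>. In particular
  the four classes 5 mod 9, 2 mod 18, 8 mod 27 and 26 mod 54 cover every even integer that is
  2 mod 3, except those that are 44 mod 54. In each of the four branches 2, 4, 6, 8 mod 10 some
  class is divided by 3, and these four congruences then settle 8/27 of that class; only its part
  in 44 mod 54 needs a further modulus.
\<close>

section \<open>Partitions of the integers into residue classes\<close>

text \<open>
  The class that a node stands for is not stored: it is determined by the path from the root.
  A leaf names the modulus of a congruence that contains its class; the residue is again
  determined by the path.
\<close>

datatype class_tree =
    Class int
  | Split2 class_tree class_tree
  | Split3 class_tree class_tree class_tree
  | Split5 class_tree class_tree class_tree class_tree class_tree

text \<open>
  The arguments \<open>m\<close> and \<open>s\<close> say that the root of the tree is the class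
  \<open>s\<close> mod \<open>m\<close>. The subtrees of a node belong to the residues \<open>s\<close>,
  \<open>s + m\<close>, \<open>s + 2 * m\<close>, and so on, in this order.
\<close>

primrec covers :: "congruence list \<Rightarrow> class_tree \<Rightarrow> int \<Rightarrow> int \<Rightarrow> bool" where
  "covers C (Class n) m s \<longleftrightarrow> n dvd m \<and> (s mod n, n) \<in> set C"
| "covers C (Split2 a b) m s \<longleftrightarrow>
     covers C a (2 * m) s \<and> covers C b (2 * m) (s + m)"
| "covers C (Split3 a b c) m s \<longleftrightarrow>
     covers C a (3 * m) s \<and> covers C b (3 * m) (s + m) \<and> covers C c (3 * m) (s + 2 * m)"
| "covers C (Split5 a b c d e) m s \<longleftrightarrow>
     covers C a (5 * m) s \<and> covers C b (5 * m) (s + m) \<and> covers C c (5 * m) (s + 2 * m) \<and>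
     covers C d (5 * m) (s + 3 * m) \<and> covers C e (5 * m) (s + 4 * m)"

lemma cong_refine:
  fixes x s m p :: int
  assumes "[x = s] (mod m)" and "p > 0"
  shows "\<exists>j\<in>{0..<p}. [x = s + j * m] (mod (p * m))"
proof -
  obtain k where k: "x = s + m * k"
    using assms(1) by (metis cong_iff_lin cong_sym)
  have "x - (s + (k mod p) * m) = m * (k - k mod p)"
    using k by (simp add: algebra_simps)
  also have "\<dots> = p * m * (k div p)"
    by (simp add: minus_mod_eq_mult_div)
  finally have "[x = s + (k mod p) * m] (mod (p * m))"
    by (simp add: cong_iff_dvd_diff)
  moreover have "k mod p \<in> {0..<p}"
    using \<open>p > 0\<close> by simp
  ultimately show ?thesis by blast
qed

lemma covers_sound:
  assumes "covers C t m s" and "[x = s] (mod m)"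
  shows "\<exists>(r, n) \<in> set C. [x = r] (mod n)"
  using assms
proof (induction t arbitrary: m s)
  case (Class n)
  then have "[x = s] (mod n)"
    by (auto intro: cong_dvd_modulus)
  then have "[x = s mod n] (mod n)"
    by (simp add: cong_def)
  with Class.prems(1) show ?case
    by (intro bexI[of _ "(s mod n, n)"]) auto
next
  case (Split2 a b)
  have "{0..<2} = {0, 1 :: int}" by auto
  with cong_refine[OF Split2.prems(2), of 2] Split2 show ?case by auto
next
  case (Split3 a b c)
  have "{0..<3} = {0, 1, 2 :: int}" by auto
  with cong_refine[OF Split3.prems(2), of 3] Split3 show ?case by auto
next
  case (Split5 a b c d e)
  have "{0..<5} = {0, 1, 2, 3, 4 :: int}" by auto
  with cong_refine[OF Split5.prems(2), of 5] Split5 show ?case by auto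
qed

section \<open>The covering system\<close>

text \<open>
  The residues and the tree were found by a local search that moves one residue class at a time
  so as to reduce the number of integers modulo \<open>2^8 * 3^3 * 5^2\<close> not yet covered. The
  moduli are listed in increasing order, so that they are visibly distinct and at least 8.
\<close>

definition system8 :: "congruence list" where
  "system8 =
    [(1, 8), (5, 9), (0, 10), (7, 12), (9, 15), (13, 16), (2, 18), (8, 20), (15, 24),
     (7, 25), (8, 27), (6, 30), (5, 32), (11, 36), (18, 40), (4, 45), (3, 48), (12, 50),
     (26, 54), (16, 60), (21, 64), (52, 72), (22, 75), (38, 80), (64, 90), (27, 96),
     (2, 100), (107, 108), (106, 120), (117, 128), (44, 135), (94, 144), (42, 150),
     (158, 160), (34, 180), (171, 192), (52, 200), (71, 216), (217, 225), (166, 240),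
     (181, 256), (206, 270), (46, 288), (222, 300), (32, 320), (304, 360), (267, 384),
     (152, 400), (395, 432), (142, 450), (78, 480), (395, 540), (459, 576), (72, 600),
     (181, 640), (422, 675), (286, 720), (565, 768), (752, 800), (555, 864), (292, 900),
     (117, 960), (1043, 1080), (75, 1152), (972, 1200), (565, 1280), (692, 1350),
     (718, 1440), (1152, 1600), (843, 1728), (1642, 1800), (437, 1920), (611, 2160),
     (821, 2304), (372, 2400), (1367, 2700), (766, 2880), (2372, 3200), (1995, 3456),
     (742, 3600), (2613, 3840), (2798, 4320), (1572, 4800), (2987, 5400), (2206, 5760),
     (53, 6912), (3646, 7200), (2206, 8640), (3972, 9600), (6227, 10800), (5086, 14400),
     (16606, 17280), (13726, 21600), (16606, 28800), (11573, 34560), (22366, 43200)]"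

definition covering_tree :: class_tree where
  "covering_tree =
    Split2
      \<comment> \<open>even integers, by last digit\<close>
      (Split5
        (Class 10)
        \<comment> \<open>2 mod 10\<close>
        (Split5
          (Split2
            (Class 100)
            (Split2
              (Class 200)
              (Split2 (Class 400) (Split2 (Split2 (Class 320) (Class 1600)) (Class 800)))))
          (Class 50)
          (Split3
            (Class 75)
            (Split2
              (Split2
                (Class 600)
                (Split2
                  (Split2 (Class 2400) (Split2 (Class 4800) (Split2 (Class 9600) (Class 3200))))
                  (Class 1200)))
              (Class 300))
            (Split3 (Class 9) (Class 18) (Split3 (Class 675) (Class 27) (Class 54))))
          (Class 25)
          (Split3
            (Class 150)
            (Split3 (Class 18) (Split3 (Class 54) (Class 1350) (Class 27)) (Class 9))
            (Split3
              (Class 450)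
              (Split2 (Class 900) (Split2 (Split2 (Class 3600) (Class 144)) (Class 1800)))
              (Class 225))))
        \<comment> \<open>4 mod 10\<close>
        (Split3
          (Split3 (Class 45) (Split2 (Class 180) (Split2 (Class 72) (Class 360))) (Class 90))
          (Split3 (Class 9) (Split3 (Class 135) (Class 54) (Class 27)) (Class 18))
          (Class 15))
        \<comment> \<open>6 mod 10\<close>
        (Split3
          (Class 30)
          (Split2
            (Class 60)
            (Split2
              (Split2
                (Split3
                  (Split2
                    (Class 288)
                    (Split2
                      (Class 2880)
                      (Split2
                        (Class 5760)
                        (Split3
                          (Split5
                            (Class 14400)
                            (Class 43200)
                            (Class 7200)
                            (Class 21600)
                            (Class 28800))
                          (Class 8640)
                          (Class 17280)))))
                  (Class 720)
                  (Class 144))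
                (Class 240))
              (Class 120)))
          (Split3 (Split3 (Class 54) (Class 27) (Class 270)) (Class 18) (Class 9)))
        \<comment> \<open>8 mod 10\<close>
        (Split2
          (Class 20)
          (Split2
            (Class 40)
            (Split2
              (Class 80)
              (Split2
                (Split3
                  (Class 480)
                  (Split3 (Class 144) (Class 1440) (Class 288))
                  (Split3 (Class 18) (Class 9) (Split3 (Class 27) (Class 4320) (Class 54))))
                (Class 160))))))
      \<comment> \<open>odd integers\<close>
      (Split2
        \<comment> \<open>1 mod 4\<close>
        (Split2
          (Class 8)
          (Split2
            (Split2
              (Class 32)
              (Split2
                (Class 64)
                (Split2
                  (Split2
                    (Split3
                      (Split3
                        (Split3
                          (Class 6912)
                          (Class 27)
                          (Split5
                            (Class 640)
                            (Class 34560)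
                            (Class 1280)
                            (Class 1920)
                            (Class 135)))
                        (Class 2304)
                        (Class 9))
                      (Split5 (Class 15) (Class 960) (Class 1280) (Class 3840) (Class 640))
                      (Class 768))
                    (Class 256))
                  (Class 128))))
            (Class 16)))
        \<comment> \<open>3 mod 4\<close>
        (Split3
          (Split2
            (Split2
              (Class 48)
              (Split2
                (Class 96)
                (Split2
                  (Split2
                    (Split3
                      (Class 1152)
                      (Class 576)
                      (Split3 (Class 1728) (Class 3456) (Class 864)))
                    (Class 384))
                  (Class 192))))
            (Class 24))
          (Class 12)
          (Split3
            (Class 36)
            (Class 9)
            (Split3
              (Class 27)
              (Split2
                (Class 216)
                (Split2
                  (Split5
                    (Class 135)
                    (Class 2160)
                    (Class 1080)
                    (Class 540)
                    (Split5 (Class 25) (Class 2700) (Class 10800) (Class 5400) (Class 675)))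
                  (Class 432)))
              (Class 108)))))"

lemma covers_system8: "covers system8 covering_tree 1 0"
  unfolding covering_tree_def system8_def by simp

lemma sorted_moduli: "sorted_wrt (<) (map snd system8)"
  unfolding system8_def by simp

lemma Min_moduli: "Min (set (map snd system8)) = 8"
proof (rule Min_eqI)
  have "\<forall>n \<in> set (map snd system8). 8 \<le> n" by (simp add: system8_def)
  then show "8 \<le> n" if "n \<in> set (map snd system8)" for n using that by blast
  show "8 \<in> set (map snd system8)" by (simp add: system8_def)
qed simp

text \<open>
  The moduli 6912 and 50 alone account for the full prime powers: \<open>6912 = 2^8 * 3^3\<close> and
  \<open>25\<close> divides \<open>50\<close>.
\<close>

lemma Lcm_moduli: "Lcm (set (map snd system8)) = 2 ^ 8 * 3 ^ 3 * 5 ^ 2"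
  (is "?l = ?r")
proof (rule zdvd_antisym_nonneg)
  have "\<forall>n \<in> set (map snd system8). n dvd ?r" by (simp add: system8_def)
  then show "?l dvd ?r" by (blast intro: Lcm_least)
  have "6912 dvd ?l" by (rule dvd_Lcm) (simp add: system8_def)
  moreover have "25 dvd ?l" by (rule dvd_Lcm) (simp add: system8_def)
  moreover have "coprime (6912 :: int) 25"
    by code_simp
  ultimately have "6912 * 25 dvd ?l" by (rule divides_mult)
  then show "?r dvd ?l" by simp
qed simp_all

theorem theorem1p11:
  shows "\<exists>S. distinct_covering_system S \<and> least_modulus S = 8 \<and>
             lcm_of_moduli S = 2 ^ 8 * 3 ^ 3 * 5 ^ 2"
proof (intro exI conjI)
  have moduli: "moduli (set system8) = set (map snd system8)"
    by (simp add: moduli_def)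
  have ge8: "n \<ge> 8" if "n \<in> moduli (set system8)" for n
    using that Min_moduli Min_le[of "set (map snd system8)" n] unfolding moduli by simp
  have "[x = 0] (mod 1)" for x :: int by simp
  from covers_sound[OF covers_system8 this]
  have "\<forall>x. \<exists>(r, n) \<in> set system8. [x = r] (mod n)" by blast
  moreover have "\<forall>(r, n) \<in> set system8. n > 0"
    using ge8 by (force simp: moduli_def)
  moreover have "inj_on snd (set system8)"
    using sorted_moduli by (simp add: strict_sorted_iff distinct_map)
  ultimately show "distinct_covering_system (set system8)"
    using ge8 unfolding distinct_covering_system_def covering_system_def by force
  show "least_modulus (set system8) = 8"
    using Min_moduli by (simp add: least_modulus_def moduli)
  show "lcm_of_moduli (set system8) = 2 ^ 8 * 3 ^ 3 * 5 ^ 2"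
    using Lcm_moduli by (simp add: lcm_of_moduli_def moduli)
qed

end
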